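(* Let $\mathcal{N}=\{N_\delta:\delta\in\mathcal{D}\}$ be a stopping model. If $N_I\in\mathcal{N}$, where $\Pr(N_I=1)=1$, then each of the four transformations $max_{\mathcal{N}}(\cdot)$, $max^{-1}_{\mathcal{N}}(\cdot)$, $min_{\mathcal{N}}(\cdot)$ and $min^{-1}_{\mathcal{N}}(\cdot)$ works as a model extension of $\mathcal{X}$ for every statistical model $\mathcal{X}$; that is, for every statistical model $\mathcal{X}$, $\mathcal{X}\subseteq max_{\mathcal{N}}(\mathcal{X})$, $\mathcal{X}\subseteq max^{-1}_{\mathcal{N}}(\mathcal{X})$, $\mathcal{X}\subseteq min_{\mathcal{N}}(\mathcal{X})$ and $\mathcal{X}\subseteq min^{-1}_{\mathcal{N}}(\mathcal{X})$.
   Context: A statistical model $\mathcal{X}=\{X_\theta:\theta\in\Theta\}$ is a family of real random variables, identified with the set of their cumulative distribution functions $F_{X_\theta}$. Models are compared as sets of distributions. A stopping model $\mathcal{N}=\{N_\delta:\delta\in\mathcal{D}\}$ is a family of positive integer valued random variables ($\Pr(N_\delta=0)=0$), with probability generating functions (pgfs) $h_{N_\delta}(t)=\sum_{n\ge1}\Pr(N_\delta=n)t^n$, $t\in[0,1]$. Each $h_{N_\delta}$ is an increasing bijection of $[0,1]$ with inverse $h_{N_\delta}^{-1}$, and $\overline{h}_{N_\delta}(t)=1-h_{N_\delta}(1-t)$ is its conjugate, with inverse $\overline{h}_{N_\delta}^{-1}$. The basic transformations are $max_{\mathcal{N}}(\mathcal{X})=\{Y_{\theta,\delta}: F_{Y_{\theta,\delta}}=h_{N_\delta}(F_{X_\theta}),\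 \theta\in\Theta,\delta\in\mathcal{D}\}$, $max^{-1}_{\mathcal{N}}(\mathcal{X})=\{Y_{\theta,\delta}: F_{Y_{\theta,\delta}}=h^{-1}_{N_\delta}(F_{X_\theta}),\ \theta\in\Theta,\delta\in\mathcal{D}\}$, $min_{\mathcal{N}}(\mathcal{X})=\{Y_{\theta,\delta}: F_{Y_{\theta,\delta}}=\overline{h}_{N_\delta}(F_{X_\theta}),\ \theta\in\Theta,\delta\in\mathcal{D}\}$, $min^{-1}_{\mathcal{N}}(\mathcal{X})=\{Y_{\theta,\delta}: F_{Y_{\theta,\delta}}=\overline{h}^{-1}_{N_\delta}(F_{X_\theta}),\ \theta\in\Theta,\delta\in\mathcal{D}\}$. A transformation $\mathcal{T}$ works as a model extension of $\mathcal{X}$ if $\mathcal{X}\subseteq\mathcal{T}(\mathcal{X})$ (inclusion not necessarily strict). *)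

theory Defs
  imports "HOL-Probability.Probability"
begin

text \<open>A family of random variables consists of an index set and, for each index, a probability
  space and a measurable function on it; the members may live on different probability spaces.\<close>

definition statistical_model ::
    "'t set \<Rightarrow> ('t \<Rightarrow> 'w measure) \<Rightarrow> ('t \<Rightarrow> 'w \<Rightarrow> real) \<Rightarrow> bool" where
  "statistical_model \<Theta> M X \<longleftrightarrow>
     (\<forall>\<theta>\<in>\<Theta>. prob_space (M \<theta>) \<and> X \<theta> \<in> borel_measurable (M \<theta>))"

definition model_cdfs ::
    "'t set \<Rightarrow> ('t \<Rightarrow> 'w measure) \<Rightarrow> ('t \<Rightarrow> 'w \<Rightarrow> real) \<Rightarrow> (real \<Rightarrow> real) set" where
  "model_cdfs \<Theta> M X = {cdf (distr (M \<theta>) borel (X \<theta>)) | \<theta>. \<theta> \<in> \<Theta>}"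

definition stopping_model ::
    "'d set \<Rightarrow> ('d \<Rightarrow> 'v measure) \<Rightarrow> ('d \<Rightarrow> 'v \<Rightarrow> nat) \<Rightarrow> bool" where
  "stopping_model D Q N \<longleftrightarrow>
     (\<forall>\<delta>\<in>D. prob_space (Q \<delta>) \<and> N \<delta> \<in> measurable (Q \<delta>) (count_space UNIV) \<and>
        measure (Q \<delta>) {\<omega> \<in> space (Q \<delta>). N \<delta> \<omega> = 0} = 0)"

text \<open>The series runs over the values \<open>Suc n\<close>, i.e. over the positive integers. Only arguments
  in \<open>{0..1}\<close> are meaningful.\<close>

definition pgf :: "'v measure \<Rightarrow> ('v \<Rightarrow> nat) \<Rightarrow> real \<Rightarrow> real" where
  "pgf Q N t = (\<Sum>n. measure Q {\<omega> \<in> space Q. N \<omega> = Suc n} * t ^ Suc n)"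

definition conj_pgf :: "'v measure \<Rightarrow> ('v \<Rightarrow> nat) \<Rightarrow> real \<Rightarrow> real" where
  "conj_pgf Q N t = 1 - pgf Q N (1 - t)"

text \<open>The lemmas \<open>bij_betw_pgf\<close> and \<open>bij_betw_conj_pgf\<close> below show that these are
  inverses of bijections of \<open>{0..1}\<close>.\<close>

definition pgf_inv :: "'v measure \<Rightarrow> ('v \<Rightarrow> nat) \<Rightarrow> real \<Rightarrow> real" where
  "pgf_inv Q N = the_inv_into {0..1} (pgf Q N)"

definition conj_pgf_inv :: "'v measure \<Rightarrow> ('v \<Rightarrow> nat) \<Rightarrow> real \<Rightarrow> real" where
  "conj_pgf_inv Q N = the_inv_into {0..1} (conj_pgf Q N)"

text \<open>The measure \<open>\<mu>\<close> is the law of the random variable \<open>Y\<close> indexed by \<open>(\<theta>, \<delta>)\<close>: the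
  transformed model consists of cdfs of genuine real random variables.\<close>

definition transform_model ::
    "'d set \<Rightarrow> ('d \<Rightarrow> real \<Rightarrow> real) \<Rightarrow> (real \<Rightarrow> real) set \<Rightarrow> (real \<Rightarrow> real) set" where
  "transform_model D g \<X> =
     {cdf \<mu> | \<mu> F \<delta>. real_distribution \<mu> \<and> F \<in> \<X> \<and> \<delta> \<in> D \<and> cdf \<mu> = (\<lambda>x. g \<delta> (F x))}"

definition max_model ::
    "'d set \<Rightarrow> ('d \<Rightarrow> 'v measure) \<Rightarrow> ('d \<Rightarrow> 'v \<Rightarrow> nat) \<Rightarrow> (real \<Rightarrow> real) set \<Rightarrow> (real \<Rightarrow> real) set" where
  "max_model D Q N = transform_model D (\<lambda>\<delta>. pgf (Q \<delta>) (N \<delta>))"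

definition max_inv_model ::
    "'d set \<Rightarrow> ('d \<Rightarrow> 'v measure) \<Rightarrow> ('d \<Rightarrow> 'v \<Rightarrow> nat) \<Rightarrow> (real \<Rightarrow> real) set \<Rightarrow> (real \<Rightarrow> real) set" where
  "max_inv_model D Q N = transform_model D (\<lambda>\<delta>. pgf_inv (Q \<delta>) (N \<delta>))"

definition min_model ::
    "'d set \<Rightarrow> ('d \<Rightarrow> 'v measure) \<Rightarrow> ('d \<Rightarrow> 'v \<Rightarrow> nat) \<Rightarrow> (real \<Rightarrow> real) set \<Rightarrow> (real \<Rightarrow> real) set" where
  "min_model D Q N = transform_model D (\<lambda>\<delta>. conj_pgf (Q \<delta>) (N \<delta>))"

definition min_inv_model ::
    "'d set \<Rightarrow> ('d \<Rightarrow> 'v measure) \<Rightarrow> ('d \<Rightarrow> 'v \<Rightarrow> nat) \<Rightarrow> (real \<Rightarrow> real) set \<Rightarrow> (real \<Rightarrow> real) set" where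
  "min_inv_model D Q N = transform_model D (\<lambda>\<delta>. conj_pgf_inv (Q \<delta>) (N \<delta>))"

definition model_extension ::
    "((real \<Rightarrow> real) set \<Rightarrow> (real \<Rightarrow> real) set) \<Rightarrow> (real \<Rightarrow> real) set \<Rightarrow> bool" where
  "model_extension T \<X> \<longleftrightarrow> \<X> \<subseteq> T \<X>"

lemma stopping_model_probs_sums:
  assumes "stopping_model D Q N" and "\<delta> \<in> D"
  shows "(\<lambda>n. measure (Q \<delta>) {\<omega> \<in> space (Q \<delta>). N \<delta> \<omega> = Suc n}) sums 1"
proof -
  let ?A = "\<lambda>n. {\<omega> \<in> space (Q \<delta>). N \<delta> \<omega> = n}"
  interpret prob_space "Q \<delta>" using assms by (simp add: stopping_model_def)
  have meas [measurable]: "N \<delta> \<in> measurable (Q \<delta>) (count_space UNIV)"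
    and zero: "prob (?A 0) = 0"
    using assms by (simp_all add: stopping_model_def)
  have "(\<lambda>n. prob (?A n)) sums prob (\<Union>n. ?A n)"
    by (rule finite_measure_UNION) (auto simp: disjoint_family_on_def)
  also have "(\<Union>n. ?A n) = space (Q \<delta>)" by auto
  finally have "(\<lambda>n. prob (?A n)) sums 1" by (simp add: prob_space)
  then show ?thesis using zero sums_Suc_iff[of "\<lambda>n. prob (?A n)" 1] by simp
qed

lemma bij_betw_pgf:
  assumes "stopping_model D Q N" and "\<delta> \<in> D"
  shows "strict_mono_on {0..1} (pgf (Q \<delta>) (N \<delta>))"
    and "bij_betw (pgf (Q \<delta>) (N \<delta>)) {0..1} {0..1}"
proof -
  define p where "p = (\<lambda>n. measure (Q \<delta>) {\<omega> \<in> space (Q \<delta>). N \<delta> \<omega> = Suc n})"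
  let ?h = "pgf (Q \<delta>) (N \<delta>)"
  have p: "p sums 1" using stopping_model_probs_sums[OF assms] by (simp add: p_def)
  have p_nn: "p n \<ge> 0" for n by (simp add: p_def)
  have h: "?h t = (\<Sum>n. p n * t ^ Suc n)" for t by (simp add: pgf_def p_def)
  have le: "norm (p n * t ^ Suc n) \<le> p n" if "t \<in> {0..1}" for n t
  proof -
    have "t ^ Suc n \<le> 1" using that by (intro power_le_one) auto
    then have "p n * t ^ Suc n \<le> p n * 1" by (intro mult_left_mono p_nn)
    then show ?thesis using that p_nn[of n] by (simp add: abs_mult)
  qed
  have sm: "summable (\<lambda>n. p n * t ^ Suc n)" if "t \<in> {0..1}" for t
    using le[OF that] sums_summable[OF p] by (rule summable_comparison_test'[rotated])
  obtain k where k: "p k > 0"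
  proof (rule ccontr)
    assume "\<not> thesis"
    then have "p = (\<lambda>_. 0)" using that p_nn by (intro ext antisym) (auto simp: not_less[symmetric])
    then show False using p sums_unique2[OF p, of 0] by simp
  qed
  show mono: "strict_mono_on {0..1} ?h"
  proof (rule strict_mono_onI)
    fix s t :: real assume st: "s \<in> {0..1}" "t \<in> {0..1}" "s < t"
    have pow: "s ^ Suc n < t ^ Suc n" for n using st by (intro power_strict_mono) auto
    have "0 < (\<Sum>n. p n * t ^ Suc n - p n * s ^ Suc n)"
    proof (rule suminf_pos2)
      show "summable (\<lambda>n. p n * t ^ Suc n - p n * s ^ Suc n)"
        by (intro summable_diff sm st)
      show "0 \<le> p n * t ^ Suc n - p n * s ^ Suc n" for n
        using mult_left_mono[OF less_imp_le[OF pow] p_nn] by simp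
      show "0 < p k * t ^ Suc k - p k * s ^ Suc k"
        using mult_strict_left_mono[OF pow k] by simp
    qed
    then show "?h s < ?h t"
      unfolding h by (subst (asm) suminf_diff[symmetric]) (auto intro: sm st simp del: power_Suc)
  qed
  have cont: "continuous_on {0..1} ?h"
  proof -
    have "uniform_limit {0..1} (\<lambda>n t. \<Sum>i<n. p i * t ^ Suc i) ?h sequentially"
      unfolding h using le sums_summable[OF p] by (intro Weierstrass_m_test) auto
    then show ?thesis
      by (rule uniform_limit_theorem[rotated]) (auto intro!: always_eventually continuous_intros)
  qed
  have h0: "?h 0 = 0" and h1: "?h 1 = 1" using sums_unique[OF p] by (simp_all add: h)
  have "?h ` {0..1} = {0..1}"
  proof
    show "?h ` {0..1} \<subseteq> {0..1}"
      using strict_mono_on_leD[OF mono, of 0] strict_mono_on_leD[OF mono, of _ 1] h0 h1 by auto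
    show "{0..1} \<subseteq> ?h ` {0..1}"
    proof
      fix y :: real assume "y \<in> {0..1}"
      then show "y \<in> ?h ` {0..1}"
        using IVT'[of ?h 0 y 1] cont h0 h1 by force
    qed
  qed
  then show "bij_betw ?h {0..1} {0..1}"
    using strict_mono_on_imp_inj_on[OF mono] by (simp add: bij_betw_def)
qed

lemma bij_betw_conj_pgf:
  assumes "stopping_model D Q N" and "\<delta> \<in> D"
  shows "bij_betw (conj_pgf (Q \<delta>) (N \<delta>)) {0..1} {0..1}"
proof -
  have refl: "bij_betw (\<lambda>t::real. 1 - t) {0..1} {0..1}"
    by (rule bij_betw_byWitness[where f' = "\<lambda>t. 1 - t"]) auto
  have "conj_pgf (Q \<delta>) (N \<delta>) = (\<lambda>t. 1 - t) \<circ> (pgf (Q \<delta>) (N \<delta>) \<circ> (\<lambda>t. 1 - t))"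
    by (auto simp: conj_pgf_def)
  then show ?thesis
    using bij_betw_trans[OF bij_betw_trans[OF refl bij_betw_pgf(2)[OF assms]] refl] by simp
qed

end

theory Submission
  imports Defs
begin

text \<open>If \<open>N\<close> is almost surely \<open>1\<close>, its pgf is the identity. The identity is its own conjugate and
  its own inverse, so at such a member of the stopping model all four transformations send a cdf
  in the model to itself. As a cdf of a real random variable is the cdf of a real distribution,
  it belongs to the transformed model. The one computation is \<open>pgf_degenerate\<close>; the passage from
  ``the identity occurs among the maps'' to ``the model is extended'' is \<open>model_extension_transform_model\<close>.\<close>

text \<open>The atom at \<open>1\<close> already exhausts the total mass \<open>1\<close>, so every other coefficient of
  the power series vanishes.\<close>

lemma pgf_degenerate:
  assumes "stopping_model D Q N" and "\<delta> \<in> D"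
    and one: "measure (Q \<delta>) {\<omega> \<in> space (Q \<delta>). N \<delta> \<omega> = 1} = 1"
  shows "pgf (Q \<delta>) (N \<delta>) t = t"
proof -
  define p where "p = (\<lambda>n. measure (Q \<delta>) {\<omega> \<in> space (Q \<delta>). N \<delta> \<omega> = Suc n})"
  have p: "p sums 1"
    using stopping_model_probs_sums[OF assms(1,2)] by (simp add: p_def)
  have p0: "p 0 = 1"
    using one by (simp add: p_def)
  have "p n = 0" if "n \<noteq> 0" for n
  proof -
    have "sum p {0, n} \<le> suminf p"
      by (intro sum_le_suminf sums_summable[OF p]) (auto simp: p_def)
    then have "p n \<le> 0"
      using that p0 sums_unique[OF p] by simp
    then show ?thesis
      by (simp add: p_def antisym)
  qed
  then have "(\<Sum>n. p n * t ^ Suc n) = (\<Sum>n\<in>{0}. p n * t ^ Suc n)"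
    by (intro suminf_finite) auto
  then show ?thesis
    using p0 by (simp add: pgf_def p_def)
qed

text \<open>The range condition on \<open>F\<close> is what a map that fixes only \<open>{0..1}\<close> requires; the
  inverse pgfs are such maps, their values elsewhere being arbitrary.\<close>

lemma model_extension_transform_model:
  assumes "\<delta> \<in> D" and fixed: "\<And>t. t \<in> {0..1} \<Longrightarrow> g \<delta> t = t"
    and model: "statistical_model \<Theta> M X"
  shows "model_extension (transform_model D g) (model_cdfs \<Theta> M X)"
  unfolding model_extension_def
proof
  fix F assume F: "F \<in> model_cdfs \<Theta> M X"
  then obtain \<theta> where \<theta>: "\<theta> \<in> \<Theta>" and F_eq: "F = cdf (distr (M \<theta>) borel (X \<theta>))"
    by (auto simp: model_cdfs_def)
  have \<mu>: "real_distribution (distr (M \<theta>) borel (X \<theta>))"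
    using model \<theta> by (auto simp: statistical_model_def intro: prob_space.real_distribution_distr)
  then interpret real_distribution "distr (M \<theta>) borel (X \<theta>)" .
  have "F x \<in> {0..1}" for x
    by (simp add: F_eq cdf_nonneg cdf_bounded_prob)
  then have "F = (\<lambda>x. g \<delta> (F x))"
    using fixed by simp
  then show "F \<in> transform_model D g (model_cdfs \<Theta> M X)"
    using \<mu> F F_eq \<open>\<delta> \<in> D\<close> unfolding transform_model_def by blast
qed

theorem proposition5:
  fixes D :: "'d set" and Q :: "'d \<Rightarrow> 'v measure" and N :: "'d \<Rightarrow> 'v \<Rightarrow> nat"
  assumes "stopping_model D Q N"
    and "\<exists>\<delta>\<in>D. measure (Q \<delta>) {\<omega> \<in> space (Q \<delta>). N \<delta> \<omega> = 1} = 1"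
  shows "\<forall>(\<Theta> :: 't set) (M :: 't \<Rightarrow> 'w measure) (X :: 't \<Rightarrow> 'w \<Rightarrow> real).
           statistical_model \<Theta> M X \<longrightarrow>
             model_extension (max_model D Q N) (model_cdfs \<Theta> M X) \<and>
             model_extension (max_inv_model D Q N) (model_cdfs \<Theta> M X) \<and>
             model_extension (min_model D Q N) (model_cdfs \<Theta> M X) \<and>
             model_extension (min_inv_model D Q N) (model_cdfs \<Theta> M X)"
proof (intro allI impI)
  fix \<Theta> :: "'t set" and M :: "'t \<Rightarrow> 'w measure" and X :: "'t \<Rightarrow> 'w \<Rightarrow> real"
  assume model: "statistical_model \<Theta> M X"
  obtain \<delta> where \<delta>: "\<delta> \<in> D"
    and one: "measure (Q \<delta>) {\<omega> \<in> space (Q \<delta>). N \<delta> \<omega> = 1} = 1"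
    using assms(2) by blast
  have pgf: "pgf (Q \<delta>) (N \<delta>) t = t" for t
    by (rule pgf_degenerate[OF assms(1) \<delta> one])
  then have conj: "conj_pgf (Q \<delta>) (N \<delta>) t = t" for t
    by (simp add: conj_pgf_def)
  have pgf_inv: "pgf_inv (Q \<delta>) (N \<delta>) t = t" if "t \<in> {0..1}" for t
    using that unfolding pgf_inv_def by (intro the_inv_into_f_eq) (auto simp: pgf inj_on_def)
  have conj_inv: "conj_pgf_inv (Q \<delta>) (N \<delta>) t = t" if "t \<in> {0..1}" for t
    using that unfolding conj_pgf_inv_def by (intro the_inv_into_f_eq) (auto simp: conj inj_on_def)
  note extends = model_extension_transform_model[where \<delta> = \<delta>, OF \<delta> _ model]
  show "model_extension (max_model D Q N) (model_cdfs \<Theta> M X) \<and>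
        model_extension (max_inv_model D Q N) (model_cdfs \<Theta> M X) \<and>
        model_extension (min_model D Q N) (model_cdfs \<Theta> M X) \<and>
        model_extension (min_inv_model D Q N) (model_cdfs \<Theta> M X)"
    unfolding max_model_def max_inv_model_def min_model_def min_inv_model_def
    by (intro conjI extends pgf pgf_inv conj conj_inv)
qed

end
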